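(* Suppose $F:\mathbb{R}^d\to\mathbb{R}^d$ is monotone and $1$-symmetric $(L_0,L_1)$-Lipschitz, with $F(x_* )=0$. Then the extragradient method with step sizes $\gamma_k=\omega_k=\frac{\nu}{L_0+L_1\|F(x_k)\|}$, where $\nu\exp(\nu)=\frac1{\sqrt2}$, satisfies $$\min_{0\le k\le K}\|F(x_k)\|\le\frac{\sqrt2\,L_0\|x_0-x_*\|}{\nu\sqrt{K+1}-\sqrt2\,L_1\|x_0-x_*\|}$$ for every $K\ge0$ with $K+1>\frac{2L_1^2\|x_0-x_*\|^2}{\nu^2}$.
   Context: Extragradient method (EG): $\hat x_k=x_k-\gamma_kF(x_k)$, $x_{k+1}=x_k-\omega_kF(\hat x_k)$, started from $x_0\in\mathbb{R}^d$. $F$ is $1$-symmetric $(L_0,L_1)$-Lipschitz ($L_0,L_1\ge0$) if for all $x,y$: $\|F(x)-F(y)\|\le\left(L_0+L_1\max_{\theta\in[0,1]}\|F(\theta x+(1-\theta)y)\|\right)\|x-y\|$. Monotone: $\langle F(x)-F(y),x-y\rangle\ge0$ for all $x,y$. *)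

theory Defs
  imports "HOL-Analysis.Analysis"
begin

definition monotone_operator :: "('a::real_inner \<Rightarrow> 'a) \<Rightarrow> bool" where
  "monotone_operator F \<longleftrightarrow> (\<forall>x y. (F x - F y) \<bullet> (x - y) \<ge> 0)"

text \<open>
  The maximum of the norm of \<open>F\<close> over a segment is an element \<open>M\<close> of the infinite set of its
  values that bounds all of them.  Neither \<open>Max\<close> (meant for finite sets) nor the conditionally
  complete \<open>Sup\<close> (unspecified on unbounded sets) is used; as in the usual reading of ``max'',
  the definition requires the maximum to exist on every segment.
\<close>

definition is_maximum :: "real set \<Rightarrow> real \<Rightarrow> bool" where
  "is_maximum S M \<longleftrightarrow> M \<in> S \<and> (\<forall>s\<in>S. s \<le> M)"

definition one_symmetric_Lipschitz ::
    "real \<Rightarrow> real \<Rightarrow> ('a::real_normed_vector \<Rightarrow> 'a) \<Rightarrow> bool" where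
  "one_symmetric_Lipschitz L0 L1 F \<longleftrightarrow>
     L0 \<ge> 0 \<and> L1 \<ge> 0 \<and>
     (\<forall>x y. \<exists>M.
        is_maximum ((\<lambda>\<theta>. norm (F (\<theta> *\<^sub>R x + (1 - \<theta>) *\<^sub>R y))) ` {0..1}) M \<and>
        norm (F x - F y) \<le> (L0 + L1 * M) * norm (x - y))"

definition extragradient ::
    "('a::real_vector \<Rightarrow> 'a) \<Rightarrow> (nat \<Rightarrow> real) \<Rightarrow> (nat \<Rightarrow> real) \<Rightarrow> (nat \<Rightarrow> 'a) \<Rightarrow> bool" where
  "extragradient F \<gamma> \<omega> x \<longleftrightarrow>
     (\<forall>k. let xhat = x k - \<gamma> k *\<^sub>R F (x k)
          in x (Suc k) = x k - \<omega> k *\<^sub>R F xhat)"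

text \<open>
  The denominator vanishes only if \<open>L0 = 0\<close> and either \<open>L1 = 0\<close> or \<open>F (x k) = 0\<close>.  In the theorem
  \<open>F\<close> has a zero, and then \<open>F\<close> vanishes identically when \<open>L0 = 0\<close>, so the convention \<open>\<nu> / 0 = 0\<close>
  does not affect the iterates.
\<close>

definition eg_stepsize ::
    "real \<Rightarrow> real \<Rightarrow> real \<Rightarrow> ('a::real_normed_vector \<Rightarrow> 'a) \<Rightarrow> (nat \<Rightarrow> 'a) \<Rightarrow> nat \<Rightarrow> real" where
  "eg_stepsize \<nu> L0 L1 F x k = \<nu> / (L0 + L1 * norm (F (x k)))"

end

theory Submission
  imports Defs
begin

text \<open>
  Write \<open>u z = L0 + L1 * norm (F z)\<close>, the local Lipschitz constant of \<open>F\<close> at \<open>z\<close>.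

  The first half of the proof replaces the maximum over a segment by the value at an end point:
  \<open>u y \<le> exp (L1 * norm (x - y)) * u x\<close> (lemma \<open>local_constant_exp_growth\<close>).  This is Gronwall's
  inequality for \<open>u\<close> along the segment.  It is obtained by a subdivision:
  if \<open>w\<close> maximizes \<open>norm \<circ> F\<close> on a segment of length \<open>d\<close> that starts at \<open>x\<close>, then comparing \<open>w\<close>
  with \<open>x\<close> gives \<open>u w \<le> u x + L1 * d * u w\<close>.  Chaining this over \<open>n\<close> equal pieces of the segment
  from \<open>x\<close> to \<open>y\<close> bounds \<open>(1 - L1 * norm (x - y) / n) ^ n * u y\<close> by \<open>u x\<close>, and the exponential
  appears as \<open>n\<close> grows.

  In the second half, the step size \<open>\<nu> / u x\<close> makes the extrapolation step so short that
  \<open>L1 * norm (xhat - x) \<le> \<nu>\<close>, whence \<open>norm (F xhat - F x) \<le> \<nu> * exp \<nu> * norm (F x)\<close>.  With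
  \<open>\<nu> * exp \<nu> = 1 / sqrt 2\<close>, monotonicity shows that an iteration with step size \<open>\<gamma>\<close> decreases
  the squared distance to the solution by at least \<open>\<gamma>\<^sup>2 * (norm (F x))\<^sup>2 / 2\<close>.  The sum of these
  decreases is at most the initial squared distance.  If \<open>L0 > 0\<close>, then
  \<open>\<gamma> * norm (F x) = \<nu> * t / (L0 + L1 * t)\<close> is increasing in \<open>t = norm (F x)\<close>, so each decrease is
  bounded below by the same expression at the smallest residual \<open>m\<close>; taking square roots and
  clearing the denominator \<open>L0 + L1 * m\<close> leaves an inequality that is linear in \<open>m\<close>.
  If \<open>L0 = 0\<close>, then \<open>F\<close> is identically zero.
\<close>

section \<open>Exponential growth of the local Lipschitz constant\<close>

lemma one_symmetric_Lipschitz_segmentE: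
  fixes F :: "'a::real_normed_vector \<Rightarrow> 'a"
  assumes "one_symmetric_Lipschitz L0 L1 F"
  obtains w where "w \<in> closed_segment x y"
    and "\<And>z. z \<in> closed_segment x y \<Longrightarrow> norm (F z) \<le> norm (F w)"
    and "norm (F x - F y) \<le> (L0 + L1 * norm (F w)) * norm (x - y)"
proof -
  obtain M where
    M: "is_maximum ((\<lambda>\<theta>. norm (F (\<theta> *\<^sub>R x + (1 - \<theta>) *\<^sub>R y))) ` {0..1}) M"
    and le: "norm (F x - F y) \<le> (L0 + L1 * M) * norm (x - y)"
    using assms unfolding one_symmetric_Lipschitz_def by blast
  have "closed_segment x y = (\<lambda>\<theta>. \<theta> *\<^sub>R x + (1 - \<theta>) *\<^sub>R y) ` {0..1}"
    by (subst closed_segment_commute) (simp add: closed_segment_image_interval add.commute)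
  then have "is_maximum ((\<lambda>z. norm (F z)) ` closed_segment x y) M"
    using M by (simp add: image_image)
  then show thesis
    using le that unfolding is_maximum_def by auto
qed

text \<open>
  The maximizer \<open>w\<close> on the segment has \<open>u w \<le> u x + L1 * norm (x - y) * u w\<close>, because the maximum
  over the sub-segment from \<open>x\<close> to \<open>w\<close> does not exceed the one over the whole segment.
\<close>

lemma local_constant_short_segment:
  fixes F :: "'a::real_normed_vector \<Rightarrow> 'a"
  assumes F: "one_symmetric_Lipschitz L0 L1 F"
    and short: "L1 * norm (x - y) \<le> 1"
  shows "(1 - L1 * norm (x - y)) * (L0 + L1 * norm (F y)) \<le> L0 + L1 * norm (F x)"
proof -
  have L: "L0 \<ge> 0" "L1 \<ge> 0"
    using F by (auto simp: one_symmetric_Lipschitz_def)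
  obtain w where w: "w \<in> closed_segment x y"
    and max_w: "\<And>z. z \<in> closed_segment x y \<Longrightarrow> norm (F z) \<le> norm (F w)"
    using one_symmetric_Lipschitz_segmentE[OF F, of x y] by blast
  obtain v where v: "v \<in> closed_segment x w"
    and le_v: "norm (F x - F w) \<le> (L0 + L1 * norm (F v)) * norm (x - w)"
    using one_symmetric_Lipschitz_segmentE[OF F, of x w] by blast
  have "v \<in> closed_segment x y"
    using v w by (meson ends_in_segment(1) subset_closed_segment subsetD)
  then have vw: "norm (F v) \<le> norm (F w)"
    by (rule max_w)
  have xw: "norm (x - w) \<le> norm (x - y)"
    using w by (metis segment_bound(1) norm_minus_commute)
  have "norm (F w) \<le> norm (F x) + norm (F x - F w)"
    by (metis norm_triangle_sub norm_minus_commute)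
  also have "\<dots> \<le> norm (F x) + (L0 + L1 * norm (F w)) * norm (x - y)"
    by (intro add_left_mono order_trans[OF le_v] mult_mono add_mono mult_left_mono vw xw)
      (use L in auto)
  finally have "L1 * norm (F w) \<le> L1 * (norm (F x) + (L0 + L1 * norm (F w)) * norm (x - y))"
    using L by (intro mult_left_mono)
  then have "(1 - L1 * norm (x - y)) * (L0 + L1 * norm (F w)) \<le> L0 + L1 * norm (F x)"
    by (simp add: algebra_simps)
  moreover have "(1 - L1 * norm (x - y)) * (L0 + L1 * norm (F y))
      \<le> (1 - L1 * norm (x - y)) * (L0 + L1 * norm (F w))"
    using short L max_w[of y] by (intro mult_left_mono add_left_mono) auto
  ultimately show ?thesis
    by linarith
qed

text \<open>
  Gronwall's inequality for the local Lipschitz constant: the bound for short segments is chained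
  over \<open>n\<close> equal pieces of the segment from \<open>x\<close> to \<open>y\<close>, and \<open>n\<close> tends to infinity.
\<close>

lemma local_constant_exp_growth:
  fixes F :: "'a::real_normed_vector \<Rightarrow> 'a"
  assumes F: "one_symmetric_Lipschitz L0 L1 F"
  shows "L0 + L1 * norm (F y) \<le> exp (L1 * norm (x - y)) * (L0 + L1 * norm (F x))"
proof -
  define u where "u z = L0 + L1 * norm (F z)" for z
  define q where "q = L1 * norm (x - y)"
  have pieces: "(1 + - q / real n) ^ n * u y \<le> u x" if n: "n > 0" "q \<le> real n" for n :: nat
  proof -
    define z where "z k = x + (real k / real n) *\<^sub>R (y - x)" for k :: nat
    have "(1 - q / real n) ^ k * u (z k) \<le> u x" for k
    proof (induction k)
      case 0
      then show ?case by (simp add: z_def)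
    next
      case (Suc k)
      have "z k - z (Suc k) = (1 / real n) *\<^sub>R (x - y)"
        by (simp add: z_def add_divide_distrib algebra_simps)
      then have len: "L1 * norm (z k - z (Suc k)) = q / real n"
        by (simp add: q_def)
      have "(1 - q / real n) * u (z (Suc k)) \<le> u (z k)"
        using local_constant_short_segment[OF F, of "z k" "z (Suc k)"] n
        unfolding len u_def by simp
      then have "(1 - q / real n) ^ k * ((1 - q / real n) * u (z (Suc k)))
          \<le> (1 - q / real n) ^ k * u (z k)"
        using n by (intro mult_left_mono zero_le_power) auto
      also note Suc.IH
      finally show ?case
        by (simp add: mult_ac)
    qed
    from this[of n] show ?thesis
      using n by (simp add: z_def)
  qed
  have "(\<lambda>n. (1 + - q / real n) ^ n * u y) \<longlonglongrightarrow> exp (- q) * u y"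
    by (intro tendsto_intros tendsto_exp_limit_sequentially)
  moreover have "\<forall>\<^sub>F n in sequentially. (1 + - q / real n) ^ n * u y \<le> u x"
  proof (rule eventually_sequentiallyI)
    fix n assume "n \<ge> max 1 (nat \<lceil>q\<rceil>)"
    then show "(1 + - q / real n) ^ n * u y \<le> u x"
      by (intro pieces) linarith+
  qed
  ultimately have "exp (- q) * u y \<le> u x"
    by (intro tendsto_upperbound[where F = sequentially]) auto
  then show ?thesis
    by (simp add: u_def q_def exp_minus field_simps)
qed

lemma one_symmetric_Lipschitz_exp_bound:
  fixes F :: "'a::real_normed_vector \<Rightarrow> 'a"
  assumes F: "one_symmetric_Lipschitz L0 L1 F"
  shows "norm (F x - F y)
    \<le> exp (L1 * norm (x - y)) * (L0 + L1 * norm (F x)) * norm (x - y)"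
proof -
  have L: "L0 \<ge> 0" "L1 \<ge> 0"
    using F by (auto simp: one_symmetric_Lipschitz_def)
  obtain w where w: "w \<in> closed_segment x y"
    and le_w: "norm (F x - F y) \<le> (L0 + L1 * norm (F w)) * norm (x - y)"
    using one_symmetric_Lipschitz_segmentE[OF F, of x y] by blast
  have xw: "norm (x - w) \<le> norm (x - y)"
    using w by (metis segment_bound(1) norm_minus_commute)
  have "L0 + L1 * norm (F w) \<le> exp (L1 * norm (x - w)) * (L0 + L1 * norm (F x))"
    by (rule local_constant_exp_growth[OF F])
  also have "\<dots> \<le> exp (L1 * norm (x - y)) * (L0 + L1 * norm (F x))"
    using L xw by (intro mult_right_mono) (auto intro: mult_left_mono)
  finally show ?thesis
    by (intro order_trans[OF le_w] mult_right_mono) auto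
qed

section \<open>Decrease of the distance to the solution\<close>

text \<open>
  A step of size \<open>g\<close> moves \<open>x\<close> by \<open>g * norm (F x)\<close>.  Since \<open>L1 * norm (F x)\<close> is at most the
  denominator of \<open>g\<close>, this is short enough for the exponential factor to stay below \<open>exp \<nu>\<close>.
\<close>

lemma extrapolation_residual:
  fixes F :: "'a::real_normed_vector \<Rightarrow> 'a"
  assumes F: "one_symmetric_Lipschitz L0 L1 F" and "\<nu> \<ge> 0"
    and g: "g = \<nu> / (L0 + L1 * norm (F x))"
  shows "norm (F (x - g *\<^sub>R F x) - F x) \<le> \<nu> * exp \<nu> * norm (F x)"
proof -
  define a where "a = L0 + L1 * norm (F x)"
  have L: "L0 \<ge> 0" "L1 \<ge> 0"
    using F by (auto simp: one_symmetric_Lipschitz_def)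
  then have a: "a \<ge> 0" "L1 * norm (F x) \<le> a"
    by (auto simp: a_def)
  have g0: "g \<ge> 0"
    using a \<open>\<nu> \<ge> 0\<close> by (simp add: g a_def)
  \<comment> \<open>Inequality rather than equality, since \<open>g = 0\<close> when \<open>a = 0\<close>.\<close>
  have ag: "a * g \<le> \<nu>"
    using \<open>\<nu> \<ge> 0\<close> by (simp add: g a_def[symmetric])
  have "L1 * (g * norm (F x)) \<le> a * g"
    using mult_right_mono[OF a(2) g0] by (simp add: mult_ac)
  then have e: "exp (L1 * (g * norm (F x))) \<le> exp \<nu>"
    using ag by simp
  have "norm (F (x - g *\<^sub>R F x) - F x) = norm (F x - F (x - g *\<^sub>R F x))"
    by (rule norm_minus_commute)
  also have "\<dots> \<le> exp (L1 * (g * norm (F x))) * a * (g * norm (F x))"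
    using one_symmetric_Lipschitz_exp_bound[OF F, of x "x - g *\<^sub>R F x"] g0
    by (simp add: a_def)
  also have "\<dots> = exp (L1 * (g * norm (F x))) * (a * g) * norm (F x)"
    by (simp add: mult_ac)
  also have "\<dots> \<le> exp \<nu> * \<nu> * norm (F x)"
    using a g0 by (intro mult_right_mono mult_mono e ag) auto
  finally show ?thesis
    by (simp add: mult_ac)
qed

text \<open>
  Monotonicity at \<open>xhat = x - g *\<^sub>R F x\<close> and the zero \<open>s\<close> gives
  \<open>F xhat \<bullet> (x - s) \<ge> g * (F xhat \<bullet> F x)\<close>.  After expanding the square of \<open>x - g *\<^sub>R F xhat - s\<close>,
  the factor of \<open>g\<^sup>2\<close> is \<open>- 2 * (F xhat \<bullet> F x) + F xhat \<bullet> F xhat\<close>, the difference of the squared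
  norms of \<open>F xhat - F x\<close> and \<open>F x\<close>.
\<close>

lemma extragradient_step:
  fixes F :: "'a::real_inner \<Rightarrow> 'a"
  assumes mono: "monotone_operator F" and zero: "F s = 0" and g: "g \<ge> 0"
  shows "(norm (x - g *\<^sub>R F (x - g *\<^sub>R F x) - s))\<^sup>2
    \<le> (norm (x - s))\<^sup>2 + g\<^sup>2 * ((norm (F (x - g *\<^sub>R F x) - F x))\<^sup>2 - (norm (F x))\<^sup>2)"
proof -
  define h where "h = F (x - g *\<^sub>R F x)"
  have "h \<bullet> (x - g *\<^sub>R F x - s) \<ge> 0"
    using mono zero unfolding monotone_operator_def h_def by (metis diff_zero)
  then have "g * (h \<bullet> (x - g *\<^sub>R F x - s)) \<ge> 0"
    using g by (rule mult_nonneg_nonneg[rotated])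
  moreover have "(norm (x - g *\<^sub>R h - s))\<^sup>2
      = (norm (x - s))\<^sup>2 + g\<^sup>2 * ((norm (h - F x))\<^sup>2 - (norm (F x))\<^sup>2)
        - 2 * (g * (h \<bullet> (x - g *\<^sub>R F x - s)))"
    unfolding power2_norm_eq_inner
    by (simp add: power2_eq_square inner_simps inner_commute algebra_simps)
  ultimately show ?thesis
    unfolding h_def by linarith
qed

lemma extragradient_decrease:
  fixes F :: "'a::real_inner \<Rightarrow> 'a"
  assumes mono: "monotone_operator F" and F: "one_symmetric_Lipschitz L0 L1 F"
    and zero: "F s = 0" and nu: "\<nu> \<ge> 0" "\<nu> * exp \<nu> = 1 / sqrt 2"
    and g: "g = \<nu> / (L0 + L1 * norm (F x))"
  shows "(norm (x - g *\<^sub>R F (x - g *\<^sub>R F x) - s))\<^sup>2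
    \<le> (norm (x - s))\<^sup>2 - (g * norm (F x))\<^sup>2 / 2"
proof -
  have g0: "g \<ge> 0"
    using F nu by (simp add: g one_symmetric_Lipschitz_def)
  have "(norm (F (x - g *\<^sub>R F x) - F x))\<^sup>2 \<le> (1 / sqrt 2 * norm (F x))\<^sup>2"
    using extrapolation_residual[OF F nu(1) g] unfolding nu(2) by (rule power_mono) simp
  also have "\<dots> = (norm (F x))\<^sup>2 / 2"
    by (simp add: power_mult_distrib power_divide)
  finally have "g\<^sup>2 * ((norm (F (x - g *\<^sub>R F x) - F x))\<^sup>2 - (norm (F x))\<^sup>2)
      \<le> g\<^sup>2 * ((norm (F x))\<^sup>2 / 2 - (norm (F x))\<^sup>2)"
    by (intro mult_left_mono) auto
  then show ?thesis
    using extragradient_step[where x = x, OF mono zero g0]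
    by (simp add: power_mult_distrib field_simps)
qed

section \<open>The best residual\<close>

lemma saturation_mono:
  fixes L0 L1 m t :: real
  assumes "L0 > 0" "L1 \<ge> 0" "0 \<le> m" "m \<le> t"
  shows "m / (L0 + L1 * m) \<le> t / (L0 + L1 * t)"
proof -
  have "L0 + L1 * m > 0" "L0 + L1 * t > 0"
    using assms by (auto intro: add_pos_nonneg)
  then show ?thesis
    using assms by (simp add: divide_simps) (simp add: algebra_simps)
qed

theorem theorem4p5:
  fixes F :: "real ^ 'd \<Rightarrow> real ^ 'd" and L0 L1 \<nu> :: real
    and x :: "nat \<Rightarrow> real ^ 'd" and xstar :: "real ^ 'd"
    and \<gamma> \<omega> :: "nat \<Rightarrow> real" and K :: nat
  assumes "monotone_operator F"
    and "one_symmetric_Lipschitz L0 L1 F"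
    and "F xstar = 0"
    and "\<nu> * exp \<nu> = 1 / sqrt 2"
    and "extragradient F \<gamma> \<omega> x"
    and "\<And>k. \<gamma> k = eg_stepsize \<nu> L0 L1 F x k"
    and "\<And>k. \<omega> k = eg_stepsize \<nu> L0 L1 F x k"
    and "real K + 1 > 2 * L1\<^sup>2 * (norm (x 0 - xstar))\<^sup>2 / \<nu>\<^sup>2"
  shows "Min ((\<lambda>k. norm (F (x k))) ` {0..K})
           \<le> sqrt 2 * L0 * norm (x 0 - xstar)
               / (\<nu> * sqrt (real K + 1) - sqrt 2 * L1 * norm (x 0 - xstar))"
proof -
  note mono = assms(1) and F = assms(2) and zero = assms(3) and nu = assms(4)
  define D where "D = norm (x 0 - xstar)"
  define m where "m = Min ((\<lambda>k. norm (F (x k))) ` {0..K})"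
  have L: "L0 \<ge> 0" "L1 \<ge> 0"
    using F by (auto simp: one_symmetric_Lipschitz_def)
  have "\<nu> * exp \<nu> > 0"
    using nu by simp
  then have nu0: "\<nu> > 0"
    by (simp add: zero_less_mult_iff)
  have m_le: "m \<le> norm (F (x k))" if "k \<le> K" for k
    using that unfolding m_def by (intro Min_le) auto
  have "m \<in> (\<lambda>k. norm (F (x k))) ` {0..K}"
    unfolding m_def by (intro Min_in) auto
  then have m0: "m \<ge> 0"
    by auto
  have denom: "\<nu> * sqrt (real K + 1) - sqrt 2 * L1 * D > 0"
  proof -
    have "(sqrt 2 * L1 * D)\<^sup>2 < (\<nu> * sqrt (real K + 1))\<^sup>2"
      using assms(8) nu0 by (simp add: D_def power_mult_distrib field_simps)
    then have "sqrt 2 * L1 * D < \<nu> * sqrt (real K + 1)"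
      by (rule power2_less_imp_less) (use nu0 in simp)
    then show ?thesis
      by simp
  qed
  have "m * (\<nu> * sqrt (real K + 1) - sqrt 2 * L1 * D) \<le> sqrt 2 * L0 * D"
  proof (cases "L0 = 0")
    case True
    \<comment> \<open>The local Lipschitz constant vanishes at \<open>xstar\<close>, so \<open>F\<close> is identically zero.\<close>
    have "norm (F xstar - F (x 0)) \<le> 0"
      using one_symmetric_Lipschitz_exp_bound[OF F, of xstar "x 0"] zero True by simp
    then have "m \<le> 0"
      using m_le[of 0] zero by simp
    then show ?thesis
      using m0 True by simp
  next
    case False
    define a where "a = L0 + L1 * m"
    have L0: "L0 > 0"
      using False L by simp
    then have a: "a > 0"
      using L m0 by (auto simp: a_def intro: add_pos_nonneg)
    have decrease: "(norm (x (Suc k) - xstar))\<^sup>2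
        \<le> (norm (x k - xstar))\<^sup>2 - (\<gamma> k * norm (F (x k)))\<^sup>2 / 2" for k
    proof -
      have "\<omega> k = \<gamma> k"
        by (simp add: assms)
      then have "x (Suc k) = x k - \<gamma> k *\<^sub>R F (x k - \<gamma> k *\<^sub>R F (x k))"
        using assms(5) by (simp add: extragradient_def Let_def)
      then show ?thesis
        using extragradient_decrease[OF mono F zero less_imp_le[OF nu0] nu, of "\<gamma> k" "x k"] assms(6)
        by (simp add: eg_stepsize_def)
    qed
    have "(\<Sum>k<n. (\<gamma> k * norm (F (x k)))\<^sup>2 / 2) \<le> D\<^sup>2 - (norm (x n - xstar))\<^sup>2" for n
    proof (induction n)
      case 0
      show ?case by (simp add: D_def)
    next
      case (Suc n)
      then show ?case
        using decrease[of n] by simp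
    qed
    from this[of "Suc K"]
    have sum: "(\<Sum>k<Suc K. (\<gamma> k * norm (F (x k)))\<^sup>2 / 2) \<le> D\<^sup>2"
      by (smt (verit) zero_le_power2)
    have "(\<nu> * (m / a))\<^sup>2 / 2 \<le> (\<gamma> k * norm (F (x k)))\<^sup>2 / 2" if "k < Suc K" for k
    proof -
      have "m / a \<le> norm (F (x k)) / (L0 + L1 * norm (F (x k)))"
        using that L0 L m0 m_le[of k] unfolding a_def by (intro saturation_mono) auto
      then have "\<nu> * (m / a) \<le> \<nu> * (norm (F (x k)) / (L0 + L1 * norm (F (x k))))"
        using nu0 by (intro mult_left_mono) auto
      also have "\<dots> = \<gamma> k * norm (F (x k))"
        by (simp add: assms(6) eg_stepsize_def)
      finally have "\<nu> * (m / a) \<le> \<gamma> k * norm (F (x k))" .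
      then show ?thesis
        using nu0 m0 a by (intro divide_right_mono power_mono) auto
    qed
    then have "(\<Sum>k<Suc K. (\<nu> * (m / a))\<^sup>2 / 2) \<le> (\<Sum>k<Suc K. (\<gamma> k * norm (F (x k)))\<^sup>2 / 2)"
      by (intro sum_mono) auto
    with sum have "(real K + 1) * (\<nu> * (m / a))\<^sup>2 \<le> 2 * D\<^sup>2"
      by (simp add: add.commute)
    then have "(sqrt (real K + 1) * (\<nu> * (m / a)))\<^sup>2 \<le> (sqrt 2 * D)\<^sup>2"
      by (simp add: power_mult_distrib power_divide)
    then have "sqrt (real K + 1) * (\<nu> * (m / a)) \<le> sqrt 2 * D"
      by (rule power2_le_imp_le) (simp add: D_def)
    then have "sqrt (real K + 1) * \<nu> * m \<le> sqrt 2 * D * a"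
      using a by (simp add: field_simps)
    then show ?thesis
      by (simp add: a_def algebra_simps)
  qed
  then show ?thesis
    using denom unfolding m_def[symmetric] D_def[symmetric] by (simp add: pos_le_divide_eq)
qed

end
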